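(* Let $m,n$ be positive integers, let $\mathcal A=(a_{ijkl})\in\mathbb R^{m\times n\times m\times n}$ be a fourth order partially symmetric tensor, let $\alpha,\beta>0$, let $\bar{\mathcal B}_{\mathcal A}\in\mathbb R^{[4,m+n]}$ be the symmetric lifted tensor of $\mathcal A$, and let $\mathbf B_{\alpha,\beta}=\operatorname{diag}(2\beta^2\mathbf I_m,2\alpha^2\mathbf I_n)$. For $\mathbf w\in\mathbb R^{m+n}$ write $\mathbf w=(\mathbf w_x^\top,\mathbf w_y^\top)^\top$ with $\mathbf w_x=(w_1,\dots,w_m)^\top$ and $\mathbf w_y=(w_{m+1},\dots,w_{m+n})^\top$. Then: (1) If $(\lambda,\mathbf x,\mathbf y)$ is an $M$-eigenpair of $\mathcal A$, then $\left(\frac{\lambda}{8\alpha^2\beta^2},\left(\frac1{2\beta}\mathbf x^\top,\frac1{2\alpha}\mathbf y^\top\right)^\top\right)$ is a $\mathbf B_{\alpha,\beta}$-eigenpair of $\bar{\mathcal B}_{\mathcal A}$. (2) If $(\lambda,\mathbf w)$ is a $\mathbf B_{\alpha,\beta}$-eigenpair of $\bar{\mathcal B}_{\mathcal A}$ with $\lambda\neq0$, then $\left(8\alpha^2\beta^2\lambda,\,2\beta\mathbf w_x,\,2\alpha\mathbf w_y\right)$ is an $M$-eigenpair of $\mathcal A$. (3) Let $(0,\mathbf w)$ be a $\mathbf B_{\alpha,\beta}$-eigenpair of $\bar{\mathcal B}_{\mathcal A}$. If $\mathbf w_x\neq\mathbf 0$ and $\mathbf w_y\neq\mathbf 0$,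 then $\left(0,\frac{\mathbf w_x}{\|\mathbf w_x\|_2},\frac{\mathbf w_y}{\|\mathbf w_y\|_2}\right)$ is an $M$-eigenpair of $\mathcal A$. If either $\mathbf w_x=\mathbf 0$ or $\mathbf w_y=\mathbf 0$, then this zero eigenpair of the lifted tensor does not correspond to an $M$-eigenpair of $\mathcal A$.
   Context: Notation: $[m]=\{1,\dots,m\}$, $m+[n]=\{m+1,\dots,m+n\}$; $\mathbb R^{[4,N]}$ is the space of real fourth order tensors of size $N\times N\times N\times N$; $\mathbf I_m$ is the $m\times m$ identity matrix. A tensor $\mathcal A=(a_{ijkl})\in\mathbb R^{m\times n\times m\times n}$ is partially symmetric if $a_{ijkl}=a_{kjil}=a_{ilkj}=a_{klij}$ for all $i,k\in[m]$, $j,l\in[n]$. For $\mathbf x\in\mathbb R^m$, $\mathbf y\in\mathbb R^n$ define $\mathcal A\cdot\mathbf y\mathbf x\mathbf y\in\mathbb R^m$ and $\mathcal A\mathbf x\mathbf y\mathbf x\cdot\in\mathbb R^n$ by $$(\mathcal A\cdot\mathbf y\mathbf x\mathbf y)_i=\sum_{k\in[m];\,j,l\in[n]}a_{ijkl}y_jx_ky_l,\qquad(\mathcal A\mathbf x\mathbf y\mathbf x\cdot)_l=\sum_{i,k\in[m];\,j\in[n]}a_{ijkl}x_iy_jx_k.$$ An $M$-eigenpair of $\mathcal A$ is a triple $(\lambda,\mathbf x,\mathbf y)\in\mathbb R\times(\mathbb R^m\setminus\{\mathbf 0\})\times(\mathbb R^n\setminus\{\mathbf 0\})$ with $\mathcal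 A\cdot\mathbf y\mathbf x\mathbf y=\lambda\mathbf x$, $\mathcal A\mathbf x\mathbf y\mathbf x\cdot=\lambda\mathbf y$, $\mathbf x^\top\mathbf x=1$, $\mathbf y^\top\mathbf y=1$. The lifted tensor $\mathcal B_{\mathcal A}=(b_{t_1t_2t_3t_4})\in\mathbb R^{[4,m+n]}$ is $$b_{t_1t_2t_3t_4}=\begin{cases}a_{t_1,\,t_2-m,\,t_3,\,t_4-m},&t_1,t_3\in[m],\ t_2,t_4\in m+[n],\\ a_{t_2,\,t_3-m,\,t_4,\,t_1-m},&t_1,t_3\in m+[n],\ t_2,t_4\in[m],\\0,&\text{otherwise,}\end{cases}$$ and the symmetric lifted tensor $\bar{\mathcal B}_{\mathcal A}=(\bar b_{t_1t_2t_3t_4})\in\mathbb R^{[4,m+n]}$ is $$\bar b_{t_1t_2t_3t_4}=\tfrac16\left(b_{t_1t_2t_3t_4}+b_{t_1t_3t_2t_4}+b_{t_1t_2t_4t_3}+b_{t_2t_1t_3t_4}+b_{t_2t_1t_4t_3}+b_{t_3t_1t_4t_2}\right);$$ it is invariant under all permutations of its indices. For $\mathcal T=(\tau_{t_1t_2t_3t_4})\in\mathbb R^{[4,m+n]}$ symmetric and $\mathbf w\in\mathbb R^{m+n}$, $(\mathcal T\mathbf w^3)_{t_1}=\sum_{t_2,t_3,t_4}\tau_{t_1t_2t_3t_4}w_{t_2}w_{t_3}w_{t_4}$. A pair $(\lambda,\mathbf w)\in\mathbb R\times(\mathbb R^{m+n}\setminus\{\mathbf 0\})$ is a $\mathbf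 B_{\alpha,\beta}$-eigenpair of $\mathcal T$ if $\mathcal T\mathbf w^3=\lambda\mathbf B_{\alpha,\beta}\mathbf w$ and $\mathbf w^\top\mathbf B_{\alpha,\beta}\mathbf w=1$. *)

theory Defs
  imports "HOL-Analysis.Analysis"
begin

text \<open>The index sets \<open>[m]\<close> and \<open>[n]\<close> are finite types \<open>'m\<close> and \<open>'n\<close> (nonempty, so
  \<open>m, n \<ge> 1\<close>), and \<open>[m + n]\<close> is the sum type \<open>'m + 'n\<close>: \<open>Inl i\<close> stands for \<open>i \<in> [m]\<close> and
  \<open>Inr j\<close> for \<open>m + j \<in> m + [n]\<close>. Tensor entries are \<open>A $ i $ j $ k $ l\<close>.\<close>

type_synonym ('m, 'n) biquad_tensor = "real ^ 'n ^ 'm ^ 'n ^ 'm"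
type_synonym 'k tensor4 = "real ^ 'k ^ 'k ^ 'k ^ 'k"

definition partially_symmetric :: "('m::finite, 'n::finite) biquad_tensor \<Rightarrow> bool" where
  "partially_symmetric A \<longleftrightarrow>
     (\<forall>i j k l. A $ i $ j $ k $ l = A $ k $ j $ i $ l \<and>
                A $ i $ j $ k $ l = A $ i $ l $ k $ j \<and>
                A $ i $ j $ k $ l = A $ k $ l $ i $ j)"

definition tensor_yxy ::
    "('m::finite, 'n::finite) biquad_tensor \<Rightarrow> real ^ 'm \<Rightarrow> real ^ 'n \<Rightarrow> real ^ 'm" where
  "tensor_yxy A x y =
     (\<chi> i. \<Sum>k\<in>UNIV. \<Sum>j\<in>UNIV. \<Sum>l\<in>UNIV. A $ i $ j $ k $ l * y $ j * x $ k * y $ l)"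

definition tensor_xyx ::
    "('m::finite, 'n::finite) biquad_tensor \<Rightarrow> real ^ 'm \<Rightarrow> real ^ 'n \<Rightarrow> real ^ 'n" where
  "tensor_xyx A x y =
     (\<chi> l. \<Sum>i\<in>UNIV. \<Sum>k\<in>UNIV. \<Sum>j\<in>UNIV. A $ i $ j $ k $ l * x $ i * y $ j * x $ k)"

definition M_eigenpair ::
    "('m::finite, 'n::finite) biquad_tensor \<Rightarrow> real \<times> (real ^ 'm) \<times> (real ^ 'n) \<Rightarrow> bool" where
  "M_eigenpair A = (\<lambda>(lam, x, y).
     x \<noteq> 0 \<and> y \<noteq> 0 \<and>
     tensor_yxy A x y = lam *\<^sub>R x \<and> tensor_xyx A x y = lam *\<^sub>R y \<and>
     x \<bullet> x = 1 \<and> y \<bullet> y = 1)"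

definition lifted_tensor ::
    "('m::finite, 'n::finite) biquad_tensor \<Rightarrow> ('m + 'n) tensor4" where
  "lifted_tensor A = (\<chi> t1 t2 t3 t4.
     (case (t1, t2, t3, t4) of
        (Inl s1, Inr s2, Inl s3, Inr s4) \<Rightarrow> A $ s1 $ s2 $ s3 $ s4
      | (Inr s1, Inl s2, Inr s3, Inl s4) \<Rightarrow> A $ s2 $ s3 $ s4 $ s1
      | _ \<Rightarrow> 0))"

definition sym_lifted_tensor ::
    "('m::finite, 'n::finite) biquad_tensor \<Rightarrow> ('m + 'n) tensor4" where
  "sym_lifted_tensor A = (let b = lifted_tensor A in
     \<chi> t1 t2 t3 t4. (1/6) *
       (b $ t1 $ t2 $ t3 $ t4 + b $ t1 $ t3 $ t2 $ t4 + b $ t1 $ t2 $ t4 $ t3 +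
        b $ t2 $ t1 $ t3 $ t4 + b $ t2 $ t1 $ t4 $ t3 + b $ t3 $ t1 $ t4 $ t2))"

text \<open>Adjacent transpositions generate all permutations of the four indices.\<close>

lemma sym_lifted_tensor_symmetric:
  assumes "partially_symmetric A"
  shows "sym_lifted_tensor A $ t1 $ t2 $ t3 $ t4 = sym_lifted_tensor A $ t2 $ t1 $ t3 $ t4"
    and "sym_lifted_tensor A $ t1 $ t2 $ t3 $ t4 = sym_lifted_tensor A $ t1 $ t3 $ t2 $ t4"
    and "sym_lifted_tensor A $ t1 $ t2 $ t3 $ t4 = sym_lifted_tensor A $ t1 $ t2 $ t4 $ t3"
proof -
  have s: "A $ i $ j $ k $ l = A $ k $ j $ i $ l" "A $ i $ j $ k $ l = A $ i $ l $ k $ j"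
    for i j k l
    using assms unfolding partially_symmetric_def by blast+
  show "sym_lifted_tensor A $ t1 $ t2 $ t3 $ t4 = sym_lifted_tensor A $ t2 $ t1 $ t3 $ t4"
    and "sym_lifted_tensor A $ t1 $ t2 $ t3 $ t4 = sym_lifted_tensor A $ t1 $ t3 $ t2 $ t4"
    and "sym_lifted_tensor A $ t1 $ t2 $ t3 $ t4 = sym_lifted_tensor A $ t1 $ t2 $ t4 $ t3"
    by (cases t1; cases t2; cases t3; cases t4;
        simp add: sym_lifted_tensor_def lifted_tensor_def Let_def; metis s)+
qed

definition tensor_cube :: "'k::finite tensor4 \<Rightarrow> real ^ 'k \<Rightarrow> real ^ 'k" where
  "tensor_cube T w =
     (\<chi> t1. \<Sum>t2\<in>UNIV. \<Sum>t3\<in>UNIV. \<Sum>t4\<in>UNIV. T $ t1 $ t2 $ t3 $ t4 * w $ t2 * w $ t3 * w $ t4)"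

definition B_matrix :: "real \<Rightarrow> real \<Rightarrow> real ^ ('m::finite + 'n::finite) ^ ('m + 'n)" where
  "B_matrix \<alpha> \<beta> =
     (\<chi> s t. if s = t then (case s of Inl _ \<Rightarrow> 2 * \<beta>\<^sup>2 | Inr _ \<Rightarrow> 2 * \<alpha>\<^sup>2) else 0)"

definition B_eigenpair ::
    "real \<Rightarrow> real \<Rightarrow> ('m::finite + 'n::finite) tensor4 \<Rightarrow> real \<times> (real ^ ('m + 'n)) \<Rightarrow> bool" where
  "B_eigenpair \<alpha> \<beta> T = (\<lambda>(lam, w).
     w \<noteq> 0 \<and>
     tensor_cube T w = lam *\<^sub>R (B_matrix \<alpha> \<beta> *v w) \<and>
     w \<bullet> (B_matrix \<alpha> \<beta> *v w) = 1)"

definition join_vec :: "real ^ 'm \<Rightarrow> real ^ 'n \<Rightarrow> real ^ ('m::finite + 'n::finite)" where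
  "join_vec x y = (\<chi> t. case t of Inl i \<Rightarrow> x $ i | Inr j \<Rightarrow> y $ j)"

definition x_part :: "real ^ ('m::finite + 'n::finite) \<Rightarrow> real ^ 'm" where
  "x_part w = (\<chi> i. w $ Inl i)"

definition y_part :: "real ^ ('m::finite + 'n::finite) \<Rightarrow> real ^ 'n" where
  "y_part w = (\<chi> j. w $ Inr j)"

end

theory Submission
  imports Defs
begin

text \<open>The two blocks of the cubic form of the symmetric lifted tensor at \<open>(x, y)\<close> are exactly
  \<open>A \<cdot> y x y\<close> and \<open>A x y x \<cdot>\<close>, because each coefficient of \<open>A\<close> occurs in three positions with
  weight \<open>1/3\<close>. So a \<open>B\<close>-eigenpair solves the \<open>M\<close>-eigenpair equations up to scaling of
  \<open>x\<close> and \<open>y\<close>. Contracting the two equations with \<open>x\<close> and \<open>y\<close> gives the same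
  biquadratic form value, hence \<open>2 \<beta>\<^sup>2 |x|\<^sup>2 = 2 \<alpha>\<^sup>2 |y|\<^sup>2 = 1/2\<close> when the eigenvalue is nonzero.\<close>

lemma sum_UNIV_Plus:
  fixes f :: "'a::finite + 'b::finite \<Rightarrow> 'c::comm_monoid_add"
  shows "(\<Sum>t\<in>UNIV. f t) = (\<Sum>i\<in>UNIV. f (Inl i)) + (\<Sum>j\<in>UNIV. f (Inr j))"
  by (simp add: UNIV_Plus_UNIV[symmetric] sum.Plus comp_def del: UNIV_Plus_UNIV)

text \<open>For each of these index patterns, exactly two of the six averaged entries alternate
  between the blocks. Partial symmetry makes both equal to the same coefficient of \<open>A\<close>,
  so the weight is 2/6.\<close>

lemma sym_lifted_tensor_nth:
  assumes "partially_symmetric A"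
  shows "sym_lifted_tensor A $ Inl i $ Inr j $ Inl k $ Inr l = A $ i $ j $ k $ l / 3"
    and "sym_lifted_tensor A $ Inl i $ Inl k $ Inr j $ Inr l = A $ i $ j $ k $ l / 3"
    and "sym_lifted_tensor A $ Inl i $ Inr j $ Inr l $ Inl k = A $ i $ j $ k $ l / 3"
    and "sym_lifted_tensor A $ Inr l $ Inl i $ Inr j $ Inl k = A $ i $ j $ k $ l / 3"
    and "sym_lifted_tensor A $ Inr l $ Inr j $ Inl i $ Inl k = A $ i $ j $ k $ l / 3"
    and "sym_lifted_tensor A $ Inr l $ Inl i $ Inl k $ Inr j = A $ i $ j $ k $ l / 3"
proof -
  have "A $ k $ j $ i $ l = A $ i $ j $ k $ l" "A $ i $ l $ k $ j = A $ i $ j $ k $ l"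
    "A $ k $ l $ i $ j = A $ i $ j $ k $ l"
    using assms unfolding partially_symmetric_def by metis+
  then show "sym_lifted_tensor A $ Inl i $ Inr j $ Inl k $ Inr l = A $ i $ j $ k $ l / 3"
    and "sym_lifted_tensor A $ Inl i $ Inl k $ Inr j $ Inr l = A $ i $ j $ k $ l / 3"
    and "sym_lifted_tensor A $ Inl i $ Inr j $ Inr l $ Inl k = A $ i $ j $ k $ l / 3"
    and "sym_lifted_tensor A $ Inr l $ Inl i $ Inr j $ Inl k = A $ i $ j $ k $ l / 3"
    and "sym_lifted_tensor A $ Inr l $ Inr j $ Inl i $ Inl k = A $ i $ j $ k $ l / 3"
    and "sym_lifted_tensor A $ Inr l $ Inl i $ Inl k $ Inr j = A $ i $ j $ k $ l / 3"
    by (simp_all add: sym_lifted_tensor_def lifted_tensor_def Let_def)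
qed

text \<open>An entry of the lifted tensor can be nonzero only if its indices alternate between the
  blocks, which takes two from each. Three indices from one block never alternate, in whatever
  order.\<close>

lemma sym_lifted_tensor_nth_eq_0:
  "sym_lifted_tensor A $ Inl i $ Inl i' $ Inl i'' $ t = 0"
  "sym_lifted_tensor A $ Inl i $ Inl i' $ t $ Inl i'' = 0"
  "sym_lifted_tensor A $ Inl i $ t $ Inl i' $ Inl i'' = 0"
  "sym_lifted_tensor A $ t $ Inl i $ Inl i' $ Inl i'' = 0"
  "sym_lifted_tensor A $ Inr j $ Inr j' $ Inr j'' $ t = 0"
  "sym_lifted_tensor A $ Inr j $ Inr j' $ t $ Inr j'' = 0"
  "sym_lifted_tensor A $ Inr j $ t $ Inr j' $ Inr j'' = 0"
  "sym_lifted_tensor A $ t $ Inr j $ Inr j' $ Inr j'' = 0"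
  by (cases t; simp add: sym_lifted_tensor_def lifted_tensor_def Let_def)+

lemma tensor_cube_sym_lifted_Inl:
  assumes "partially_symmetric A"
  shows "tensor_cube (sym_lifted_tensor A) w $ Inl i = tensor_yxy A (x_part w) (y_part w) $ i"
proof -
  let ?f = "\<lambda>k j l. A $ i $ j $ k $ l * w $ Inr j * w $ Inl k * w $ Inr l / 3"
  let ?S = "\<Sum>k\<in>UNIV. \<Sum>j\<in>UNIV. \<Sum>l\<in>UNIV. ?f k j l"
  have 1: "(\<Sum>j\<in>UNIV. \<Sum>k\<in>UNIV. \<Sum>l\<in>UNIV. ?f k j l) = ?S"
    by (rule sum.swap)
  have "(\<Sum>j\<in>UNIV. \<Sum>l\<in>UNIV. \<Sum>k\<in>UNIV. ?f k j l) = (\<Sum>j\<in>UNIV. \<Sum>k\<in>UNIV. \<Sum>l\<in>UNIV. ?f k j l)"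
    by (intro sum.cong refl sum.swap)
  note 2 = this[unfolded 1]
  \<comment> \<open>Splitting the three sums by block gives eight pieces. Those with one
    \<open>Inl\<close> and two \<open>Inr\<close> survive, one for each position of the
    \<open>Inl\<close> index.\<close>
  have "tensor_cube (sym_lifted_tensor A) w $ Inl i
      = ?S + ((\<Sum>j\<in>UNIV. \<Sum>k\<in>UNIV. \<Sum>l\<in>UNIV. ?f k j l) + (\<Sum>j\<in>UNIV. \<Sum>l\<in>UNIV. \<Sum>k\<in>UNIV. ?f k j l))"
    by (simp add: tensor_cube_def sum_UNIV_Plus sym_lifted_tensor_nth[OF assms]
        sym_lifted_tensor_nth_eq_0 sum.distrib mult_ac)
  also have "\<dots> = 3 * ?S"
    unfolding 1 2 by simp
  also have "\<dots> = tensor_yxy A (x_part w) (y_part w) $ i"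
    by (simp add: tensor_yxy_def x_part_def y_part_def flip: sum_divide_distrib)
  finally show ?thesis .
qed

lemma tensor_cube_sym_lifted_Inr:
  assumes "partially_symmetric A"
  shows "tensor_cube (sym_lifted_tensor A) w $ Inr l = tensor_xyx A (x_part w) (y_part w) $ l"
proof -
  let ?f = "\<lambda>i k j. A $ i $ j $ k $ l * w $ Inl i * w $ Inr j * w $ Inl k / 3"
  let ?S = "\<Sum>i\<in>UNIV. \<Sum>k\<in>UNIV. \<Sum>j\<in>UNIV. ?f i k j"
  have 1: "(\<Sum>i\<in>UNIV. \<Sum>j\<in>UNIV. \<Sum>k\<in>UNIV. ?f i k j) = ?S"
    by (intro sum.cong refl sum.swap)
  have "(\<Sum>j\<in>UNIV. \<Sum>i\<in>UNIV. \<Sum>k\<in>UNIV. ?f i k j) = (\<Sum>i\<in>UNIV. \<Sum>j\<in>UNIV. \<Sum>k\<in>UNIV. ?f i k j)"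
    by (rule sum.swap)
  note 2 = this[unfolded 1]
  \<comment> \<open>Here the first index is \<open>Inr\<close>, so the surviving pieces have two
    \<open>Inl\<close> and one \<open>Inr\<close>; they differ only in the place of the sum over
    \<open>j\<close>.\<close>
  have "tensor_cube (sym_lifted_tensor A) w $ Inr l
      = ?S + (\<Sum>i\<in>UNIV. \<Sum>j\<in>UNIV. \<Sum>k\<in>UNIV. ?f i k j) + (\<Sum>j\<in>UNIV. \<Sum>i\<in>UNIV. \<Sum>k\<in>UNIV. ?f i k j)"
    by (simp add: tensor_cube_def sum_UNIV_Plus sym_lifted_tensor_nth[OF assms]
        sym_lifted_tensor_nth_eq_0 sum.distrib mult_ac)
  also have "\<dots> = 3 * ?S"
    unfolding 1 2 by simp
  also have "\<dots> = tensor_xyx A (x_part w) (y_part w) $ l"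
    by (simp add: tensor_xyx_def x_part_def y_part_def flip: sum_divide_distrib)
  finally show ?thesis .
qed

lemma tensor_yxy_scaleR: "tensor_yxy A (a *\<^sub>R x) (b *\<^sub>R y) = (a * b\<^sup>2) *\<^sub>R tensor_yxy A x y"
  by (simp add: vec_eq_iff tensor_yxy_def sum_distrib_left power2_eq_square mult_ac)

lemma tensor_xyx_scaleR: "tensor_xyx A (a *\<^sub>R x) (b *\<^sub>R y) = (a\<^sup>2 * b) *\<^sub>R tensor_xyx A x y"
  by (simp add: vec_eq_iff tensor_xyx_def sum_distrib_left power2_eq_square mult_ac)

text \<open>Both sides expand to one quadruple sum, the biquadratic form; the sum over
  \<open>l\<close> moves outward past \<open>j\<close>, \<open>k\<close> and \<open>i\<close> one
  swap at a time.\<close>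

lemma inner_tensor_yxy_eq_inner_tensor_xyx: "x \<bullet> tensor_yxy A x y = y \<bullet> tensor_xyx A x y"
proof -
  let ?f = "\<lambda>i k j l. A $ i $ j $ k $ l * x $ i * y $ j * x $ k * y $ l"
  have "x \<bullet> tensor_yxy A x y = (\<Sum>i\<in>UNIV. \<Sum>k\<in>UNIV. \<Sum>j\<in>UNIV. \<Sum>l\<in>UNIV. ?f i k j l)"
    by (simp add: inner_vec_def tensor_yxy_def sum_distrib_left mult_ac)
  also have "\<dots> = (\<Sum>i\<in>UNIV. \<Sum>k\<in>UNIV. \<Sum>l\<in>UNIV. \<Sum>j\<in>UNIV. ?f i k j l)"
    by (intro sum.cong refl sum.swap)
  also have "\<dots> = (\<Sum>i\<in>UNIV. \<Sum>l\<in>UNIV. \<Sum>k\<in>UNIV. \<Sum>j\<in>UNIV. ?f i k j l)"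
    by (intro sum.cong refl sum.swap)
  also have "\<dots> = (\<Sum>l\<in>UNIV. \<Sum>i\<in>UNIV. \<Sum>k\<in>UNIV. \<Sum>j\<in>UNIV. ?f i k j l)"
    by (rule sum.swap)
  also have "\<dots> = y \<bullet> tensor_xyx A x y"
    by (simp add: inner_vec_def tensor_xyx_def sum_distrib_left mult_ac)
  finally show ?thesis .
qed

lemma vec_Plus_eq_iff: "v = w \<longleftrightarrow> x_part v = x_part w \<and> y_part v = y_part w"
  by (auto simp: vec_eq_iff x_part_def y_part_def split_sum_all)

lemma inner_vec_Plus: "v \<bullet> w = x_part v \<bullet> x_part w + y_part v \<bullet> y_part w"
  by (simp add: inner_vec_def sum_UNIV_Plus x_part_def y_part_def)

lemma part_join_vec [simp]: "x_part (join_vec x y) = x" "y_part (join_vec x y) = y"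
  by (simp_all add: vec_eq_iff x_part_def y_part_def join_vec_def)

lemma part_zero [simp]: "x_part 0 = 0" "y_part 0 = 0"
  by (simp_all add: vec_eq_iff x_part_def y_part_def)

lemma part_scaleR [simp]: "x_part (c *\<^sub>R w) = c *\<^sub>R x_part w" "y_part (c *\<^sub>R w) = c *\<^sub>R y_part w"
  by (simp_all add: vec_eq_iff x_part_def y_part_def)

lemma part_B_matrix_mult [simp]:
  "x_part (B_matrix \<alpha> \<beta> *v w) = (2 * \<beta>\<^sup>2) *\<^sub>R x_part w"
  "y_part (B_matrix \<alpha> \<beta> *v w) = (2 * \<alpha>\<^sup>2) *\<^sub>R y_part w"
  by (simp_all add: vec_eq_iff x_part_def y_part_def B_matrix_def matrix_vector_mult_def
      if_distrib[where f = "\<lambda>c. c * _"] cong: if_cong)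

lemma B_eigenpair_sym_lifted_iff:
  assumes "partially_symmetric A"
  shows "B_eigenpair \<alpha> \<beta> (sym_lifted_tensor A) (lam, w) \<longleftrightarrow>
    tensor_yxy A (x_part w) (y_part w) = (2 * \<beta>\<^sup>2 * lam) *\<^sub>R x_part w \<and>
    tensor_xyx A (x_part w) (y_part w) = (2 * \<alpha>\<^sup>2 * lam) *\<^sub>R y_part w \<and>
    2 * \<beta>\<^sup>2 * (x_part w \<bullet> x_part w) + 2 * \<alpha>\<^sup>2 * (y_part w \<bullet> y_part w) = 1"
proof -
  have "x_part (tensor_cube (sym_lifted_tensor A) w) = tensor_yxy A (x_part w) (y_part w)"
    "y_part (tensor_cube (sym_lifted_tensor A) w) = tensor_xyx A (x_part w) (y_part w)"
    using tensor_cube_sym_lifted_Inl[OF assms] tensor_cube_sym_lifted_Inr[OF assms]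
    \<comment> \<open>The instantiated definitions open only the outer projections;
      \<open>x_part w\<close> and \<open>y_part w\<close> stay folded as arguments of the
      contractions.\<close>
    by (simp_all add: vec_eq_iff x_part_def[of "tensor_cube _ _"] y_part_def[of "tensor_cube _ _"])
  then have "B_eigenpair \<alpha> \<beta> (sym_lifted_tensor A) (lam, w) \<longleftrightarrow> w \<noteq> 0 \<and>
    tensor_yxy A (x_part w) (y_part w) = (2 * \<beta>\<^sup>2 * lam) *\<^sub>R x_part w \<and>
    tensor_xyx A (x_part w) (y_part w) = (2 * \<alpha>\<^sup>2 * lam) *\<^sub>R y_part w \<and>
    2 * \<beta>\<^sup>2 * (x_part w \<bullet> x_part w) + 2 * \<alpha>\<^sup>2 * (y_part w \<bullet> y_part w) = 1"
    unfolding B_eigenpair_def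
    by (simp add: vec_Plus_eq_iff[of "tensor_cube _ _"] inner_vec_Plus mult_ac)
  \<comment> \<open>At \<open>w = 0\<close> the normalisation would read \<open>0 = 1\<close>, so it
    already implies \<open>w \<noteq> 0\<close>.\<close>
  then show ?thesis
    by auto
qed

lemma M_eigenpair_iff:
  "M_eigenpair A (lam, x, y) \<longleftrightarrow>
    tensor_yxy A x y = lam *\<^sub>R x \<and> tensor_xyx A x y = lam *\<^sub>R y \<and> x \<bullet> x = 1 \<and> y \<bullet> y = 1"
  by (auto simp: M_eigenpair_def)

theorem corollary2p1:
  fixes A :: "('m::finite, 'n::finite) biquad_tensor" and \<alpha> \<beta> :: real
  assumes "partially_symmetric A" and "\<alpha> > 0" and "\<beta> > 0"
  shows
    "(\<forall>lam x y. M_eigenpair A (lam, x, y) \<longrightarrow>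
        B_eigenpair \<alpha> \<beta> (sym_lifted_tensor A)
          (lam / (8 * \<alpha>\<^sup>2 * \<beta>\<^sup>2), join_vec ((1 / (2 * \<beta>)) *\<^sub>R x) ((1 / (2 * \<alpha>)) *\<^sub>R y))) \<and>
     (\<forall>lam w. B_eigenpair \<alpha> \<beta> (sym_lifted_tensor A) (lam, w) \<and> lam \<noteq> 0 \<longrightarrow>
        M_eigenpair A
          (8 * \<alpha>\<^sup>2 * \<beta>\<^sup>2 * lam, (2 * \<beta>) *\<^sub>R x_part w, (2 * \<alpha>) *\<^sub>R y_part w)) \<and>
     (\<forall>w. B_eigenpair \<alpha> \<beta> (sym_lifted_tensor A) (0, w) \<longrightarrow>
        (x_part w \<noteq> 0 \<and> y_part w \<noteq> 0 \<longrightarrow>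
           M_eigenpair A
             (0, (1 / norm (x_part w)) *\<^sub>R x_part w, (1 / norm (y_part w)) *\<^sub>R y_part w)) \<and>
        (x_part w = 0 \<or> y_part w = 0 \<longrightarrow>
           \<not> (\<exists>\<mu> c d. M_eigenpair A (\<mu>, c *\<^sub>R x_part w, d *\<^sub>R y_part w))))"
proof (intro conjI allI impI)
  fix lam x y
  assume "M_eigenpair A (lam, x, y)"
  then have M: "tensor_yxy A x y = lam *\<^sub>R x" "tensor_xyx A x y = lam *\<^sub>R y"
      "x \<bullet> x = 1" "y \<bullet> y = 1"
    by (simp_all add: M_eigenpair_iff)
  show "B_eigenpair \<alpha> \<beta> (sym_lifted_tensor A)
      (lam / (8 * \<alpha>\<^sup>2 * \<beta>\<^sup>2), join_vec ((1 / (2 * \<beta>)) *\<^sub>R x) ((1 / (2 * \<alpha>)) *\<^sub>R y))"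
    \<comment> \<open>In the \<open>x\<close> block both sides become
      \<open>lam / (8 * \<alpha>\<^sup>2 * \<beta>)\<close> times \<open>x\<close>, and
      symmetrically for \<open>y\<close>. Each block contributes 1/2 to the normalisation.\<close>
    unfolding B_eigenpair_sym_lifted_iff[OF assms(1)] part_join_vec tensor_yxy_scaleR
      tensor_xyx_scaleR M inner_scaleR_left inner_scaleR_right scaleR_scaleR
    using assms(2,3) by (simp add: field_simps power2_eq_square)
next
  fix lam w
  assume "B_eigenpair \<alpha> \<beta> (sym_lifted_tensor A) (lam, w) \<and> lam \<noteq> 0"
  then have lam: "lam \<noteq> 0"
    and yxy: "tensor_yxy A (x_part w) (y_part w) = (2 * \<beta>\<^sup>2 * lam) *\<^sub>R x_part w"
    and xyx: "tensor_xyx A (x_part w) (y_part w) = (2 * \<alpha>\<^sup>2 * lam) *\<^sub>R y_part w"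
    and norm: "2 * \<beta>\<^sup>2 * (x_part w \<bullet> x_part w) + 2 * \<alpha>\<^sup>2 * (y_part w \<bullet> y_part w) = 1"
    by (simp_all add: B_eigenpair_sym_lifted_iff[OF assms(1)])
  \<comment> \<open>The contracted equations carry a common factor \<open>2 * lam\<close>, which
    cancels since \<open>lam \<noteq> 0\<close>.\<close>
  have "\<beta>\<^sup>2 * (x_part w \<bullet> x_part w) = \<alpha>\<^sup>2 * (y_part w \<bullet> y_part w)"
    using inner_tensor_yxy_eq_inner_tensor_xyx[of "x_part w" A "y_part w"] lam
    by (simp add: yxy xyx)
  with norm have "\<beta>\<^sup>2 * (x_part w \<bullet> x_part w) = 1 / 4" "\<alpha>\<^sup>2 * (y_part w \<bullet> y_part w) = 1 / 4"
    by simp_all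
  \<comment> \<open>The values 1/4 make the factors \<open>2 * \<beta>\<close> and
    \<open>2 * \<alpha>\<close> normalise the blocks. In the \<open>x\<close> equation \<open>(2 *
    \<beta>) * (2 * \<alpha>)\<^sup>2 * (2 * \<beta>\<^sup>2 * lam)\<close> equals the new
    eigenvalue times \<open>2 * \<beta>\<close>.\<close>
  then show "M_eigenpair A (8 * \<alpha>\<^sup>2 * \<beta>\<^sup>2 * lam, (2 * \<beta>) *\<^sub>R x_part w, (2 * \<alpha>) *\<^sub>R y_part w)"
    unfolding M_eigenpair_iff tensor_yxy_scaleR tensor_xyx_scaleR yxy xyx
    by (simp add: power2_eq_square mult_ac)
next
  fix w :: "real ^ ('m + 'n)"
  assume "B_eigenpair \<alpha> \<beta> (sym_lifted_tensor A) (0, w)" "x_part w \<noteq> 0 \<and> y_part w \<noteq> 0"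
  \<comment> \<open>With eigenvalue 0 both contractions vanish, and by homogeneity they still vanish
    after each block is scaled independently to unit length.\<close>
  then show "M_eigenpair A
      (0, (1 / norm (x_part w)) *\<^sub>R x_part w, (1 / norm (y_part w)) *\<^sub>R y_part w)"
    by (simp add: B_eigenpair_sym_lifted_iff[OF assms(1)] M_eigenpair_iff
        tensor_yxy_scaleR tensor_xyx_scaleR dot_square_norm power2_eq_square)
next
  fix w :: "real ^ ('m + 'n)"
  assume "x_part w = 0 \<or> y_part w = 0"
  \<comment> \<open>Failure to correspond is expressed as: no rescaling of the two blocks, with any
    eigenvalue, is an M-eigenpair. A zero block stays zero under scaling, while both vectors of an
    M-eigenpair are nonzero.\<close>
  then show "\<not> (\<exists>\<mu> c d. M_eigenpair A (\<mu>, c *\<^sub>R x_part w, d *\<^sub>R y_part w))"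
    by (auto simp: M_eigenpair_def)
qed

end
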